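(* Let $\gamma$ be an intersection context and let $P$ be an intersection protocol for $\gamma$. If $P$ has no unnecessary waiting with respect to $\gamma$, then $P$ is lexicographically optimal with respect to $\gamma$.
   Context: **Setting.** $\mathrm{Ag}\subseteq\mathbb N$ is a (possibly infinite) set of agents. Lanes $\mathcal L=\{0,\dots,\ell-1\}$ are partitioned into incoming lanes $\mathcal L_{in}=\{0,\dots,k-1\}$ ($1<k<\ell$) and outgoing lanes $\mathcal L_{out}$. A move is an element of $\mathcal L_{in}\times\mathcal L_{out}$. A symmetric relation $\mathcal O\subseteq(\mathcal L_{in}\times\mathcal L_{out})^2$ is fixed; two moves are compatible if the pair is in $\mathcal O$. **Adversaries.** A transmission environment is $T\subseteq(\mathcal L_{in}\times\mathbb N)^2$ with $((l,0),(l',0))\in T$ for all $l,l'\in\mathcal L_{in}$. An adversary is $\alpha=(\tau,T,F_t,F_r)$ with $\tau:\mathrm{Ag}\to\mathbb N\times\mathcal L_{in}\times\mathcal L_{out}$ (arrival time, arrival lane, intended departure lane), where distinct agents with the same arrival time have different arrival lanes; $T$ a transmission environment; $F_t,F_r:\mathbb N\times\mathrm{Ag}\to\{0,1\}$ (value $0$ at $(m,i)$: $i$'s transmitter, resp. receiver, fails in round $m+1$, i.e. between times $m$ and $m+1$). An adversary model $\mathcal F$ is a set of adversaries. **Intersection contexts.** An environment state is $s_e=(\alpha,t,(q_l)_{l\in\mathcal L_{in}},\mathit{done})$: an adversary $\alpha\in\mathcal F$, a time $t\in\mathbb N$, a queue $q_l$ of agents per incoming lane, and a set $\mathit{done}\subseteq\mathrm{Ag}$.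 $\mathit{pos}_i=p$ if $i$ is in position $p$ of some queue (front is position $0$), $\top$ if $i\in\mathit{done}$, $\bot$ otherwise. Agent $i$'s sensor reading $\mathscr S_i(s_e)\in\Sigma_i$ contains $\mathit{front}_i$ ($=1$ iff $\mathit{pos}_i=0$), $\mathit{lane}_i$ ($=l$ if $i$ is in $q_l$, $\top$ if $i\in\mathit{done}$, $\bot$ otherwise) and $\mathit{intent}_i$ (the departure lane in $\tau(i)$), and possibly further components that are functions of $s_e$ (such as the time). An information-exchange protocol $\mathcal E$ gives for each agent $i$: a set $\mathit{Mem}_i$ of memory states with a subset of initial ones, local states $L_i=\mathit{Mem}_i\times\Sigma_i$, actions $A_i=\{\mathtt{go},\mathtt{noop}\}$, messages $M_i$, $\mu_i:L_i\times A_i\times\Sigma_i\to M_i\cup\{\bot\}$ ($\bot$: no message) and $\delta_i:L_i\times A_i\times\mathcal P(\bigcup_jM_j)\to\mathit{Mem}_i$. An intersection context is $\gamma=(\mathcal E,\mathcal F,\pi)$, where $\pi$ interprets atomic propositions about $\mathit{front}_i,\mathit{lane}_i,\mathit{intent}_i,\mathit{pos}_i$ according to the global state. An action protocol $P$ for $\gamma$ consists of maps $P_i:L_i\to A_i$; $\mathtt{go}$ can be performed only by an agent at the front of its queue ($P_i(s)=\mathtt{go}$ only if $\mathit{front}_i=1$ in $s$). **Runs.** Global states are $(s_e,(s_i)_{i\in\mathrm{Ag}})$. Initially $t=0$, all queues and $\mathit{done}$ are empty, and $s_i=(u_i,\mathscr S_i(s_e))$ with $u_i$ an initial memory state. In round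 $m+1$: each $i$ performs $P_i(s_i)$; each agent at the front of a queue performing $\mathtt{go}$ is dequeued and added to $\mathit{done}$; then each agent $i$ with $\tau(i)=(m+1,l,l')$ is appended to $q_l$; time becomes $m+1$ and $\alpha$ is unchanged, giving $s_e'$. Each $i$ broadcasts $m_i=\mu_i(s_i,P_i(s_i),\mathscr S_i(s_e'))$. $B_i=\emptyset$ if $i$ is in no queue in $s'_e$ or $F_r(m,i)=0$; otherwise $B_i$ is the set of (non-$\bot$) $m_j$ for agents $j$ in some queue with ((lane, position) of $j$, (lane, position) of $i$)$\,\in T$ (in $s'_e$) and $F_t(m,j)=1$. The new local state is $s_i'=(\delta_i(s_i,P_i(s_i),B_i),\mathscr S_i(s'_e))$. $\mathcal I_{\gamma,P}$ is the interpreted system of all such runs $r:\mathbb N\to$ global states; $r_i(m)$ is $i$'s local state at point $(r,m)$. $\bigcirc\phi$ holds at $(r,m)$ iff $\phi$ holds at $(r,m+1)$; $\Diamond\phi$ iff $\phi$ holds at some $(r,m')$, $m'\ge m$. A formula is valid if it holds at all points. **Intersection protocol.** $\mathit{going}_i:=\mathit{front}_i\wedge\bigcirc\neg\mathit{front}_i$. $P$ is an intersection protocol for $\gamma$ if for all $i\ne j$ these are valid in $\mathcal I_{\gamma,P}$: Validity $\mathit{going}_i\Rightarrow\mathit{front}_i$; Safety $(\mathit{going}_i\wedge\mathit{going}_j)\Rightarrow((\mathit{lane}_i,\mathit{intent}_i),(\mathit{lane}_j,\mathit{intent}_j))\in\mathcal O$; Liveness $\mathit{front}_i\Rightarrow\Diamond\mathit{going}_i$.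 **Unnecessary waiting.** $GO(r,m)$ is the set of agents $i$ with $\mathit{going}_i$ true at $(r,m)$. $\mathit{safe\text{-}to\text{-}go}_i$ holds at $(r,m)$ if $\mathit{pos}_i=0$ there and for all distinct $j,k\in GO(r,m)\cup\{i\}$ the moves $(\mathit{lane}_j,\mathit{intent}_j)$ and $(\mathit{lane}_k,\mathit{intent}_k)$ at $(r,m)$ are compatible. $P$ has unnecessary waiting w.r.t. $\gamma$ if there are an agent $i$ and a point $(r,m)$ of $\mathcal I_{\gamma,P}$ with $\mathit{safe\text{-}to\text{-}go}_i$ true at $(r,m)$ and $i\notin GO(r,m)$. **Lexicographic optimality.** Runs $r$ of $\mathcal I_{\gamma,P}$ and $r'$ of $\mathcal I_{\gamma,P'}$ correspond if $r(0)=r'(0)$. $P$ lexicographically dominates $P'$ w.r.t. $\gamma$ if for all corresponding runs $r$ of $P$ and $r'$ of $P'$, either $GO(r,m)=GO(r',m)$ for all $m$, or at the first $m$ with $GO(r,m)\neq GO(r',m)$ we have $GO(r',m)\subsetneq GO(r,m)$; strictly if also $P'$ does not lexicographically dominate $P$. An intersection protocol $P$ is lexicographically optimal w.r.t. $\gamma$ if no intersection protocol for $\gamma$ strictly lexicographically dominates $P$. *)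

theory Defs
  imports Main "HOL-Library.FuncSet"
begin

type_synonym agent = nat
type_synonym lane = nat
type_synonym move = "lane \<times> lane"

record layout =
  agents :: "agent set"
  num_lanes :: nat
  num_in :: nat
  compatible :: "(move \<times> move) set"

definition in_lanes :: "layout \<Rightarrow> lane set" where
  "in_lanes X = {0..<num_in X}"

definition out_lanes :: "layout \<Rightarrow> lane set" where
  "out_lanes X = {num_in X..<num_lanes X}"

definition moves :: "layout \<Rightarrow> move set" where
  "moves X = in_lanes X \<times> out_lanes X"

definition valid_layout :: "layout \<Rightarrow> bool" where
  "valid_layout X \<longleftrightarrow>
     1 < num_in X \<and> num_in X < num_lanes X \<and>
     compatible X \<subseteq> moves X \<times> moves X \<and> sym (compatible X)"


section \<open>Adversaries\<close>

text \<open>Functions whose domain is the set of agents are extensional outside it, so that equality of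
  adversaries and of global states is equality of the mathematical objects. In the failure
  functions, \<open>False\<close> means that the transmitter (receiver) fails.\<close>

record adversary =
  arrival :: "agent \<Rightarrow> nat \<times> lane \<times> lane"
  transmission :: "((lane \<times> nat) \<times> (lane \<times> nat)) set"
  transmitter_ok :: "nat \<Rightarrow> agent \<Rightarrow> bool"
  receiver_ok :: "nat \<Rightarrow> agent \<Rightarrow> bool"

definition transmission_env :: "layout \<Rightarrow> ((lane \<times> nat) \<times> (lane \<times> nat)) set \<Rightarrow> bool" where
  "transmission_env X T \<longleftrightarrow>
     T \<subseteq> (in_lanes X \<times> UNIV) \<times> (in_lanes X \<times> UNIV) \<and>
     (\<forall>l\<in>in_lanes X. \<forall>l'\<in>in_lanes X. ((l, 0), (l', 0)) \<in> T)"

definition adversaries :: "layout \<Rightarrow> adversary set" where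
  "adversaries X = {\<alpha>.
     arrival \<alpha> \<in> agents X \<rightarrow>\<^sub>E UNIV \<times> in_lanes X \<times> out_lanes X \<and>
     (\<forall>i\<in>agents X. \<forall>j\<in>agents X. i \<noteq> j \<and> fst (arrival \<alpha> i) = fst (arrival \<alpha> j) \<longrightarrow>
        fst (snd (arrival \<alpha> i)) \<noteq> fst (snd (arrival \<alpha> j))) \<and>
     transmission_env X (transmission \<alpha>) \<and>
     (\<forall>m. transmitter_ok \<alpha> m \<in> agents X \<rightarrow>\<^sub>E UNIV) \<and>
     (\<forall>m. receiver_ok \<alpha> m \<in> agents X \<rightarrow>\<^sub>E UNIV)}"


section \<open>Environment states and sensors\<close>

record env_state =
  adv :: adversary
  clock :: nat
  queue :: "lane \<Rightarrow> agent list"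
  departed :: "agent set"

definition at :: "layout \<Rightarrow> env_state \<Rightarrow> agent \<Rightarrow> lane \<Rightarrow> nat \<Rightarrow> bool" where
  "at X e i l p \<longleftrightarrow> l \<in> in_lanes X \<and> p < length (queue e l) \<and> queue e l ! p = i"

text \<open>The last two conditions say that an agent is in at most one place, which is what makes its
  lane and position well defined. Queues outside the incoming lanes are empty by convention.\<close>

definition env_states :: "layout \<Rightarrow> adversary set \<Rightarrow> env_state set" where
  "env_states X F = {e.
     adv e \<in> F \<and>
     (\<forall>l\<in>in_lanes X. set (queue e l) \<subseteq> agents X) \<and>
     (\<forall>l. l \<notin> in_lanes X \<longrightarrow> queue e l = []) \<and>
     departed e \<subseteq> agents X \<and>
     (\<forall>i l p l' p'. at X e i l p \<and> at X e i l' p' \<longrightarrow> l = l' \<and> p = p') \<and>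
     (\<forall>i l p. at X e i l p \<longrightarrow> i \<notin> departed e)}"

text \<open>\<open>Top\<close> is the value for agents that are done, \<open>Bot\<close> for agents that are neither queued nor
  done.\<close>

datatype 'a status = Val 'a | Top | Bot

definition pos_of :: "layout \<Rightarrow> env_state \<Rightarrow> agent \<Rightarrow> nat status" where
  "pos_of X e i =
     (if \<exists>l p. at X e i l p then Val (THE p. \<exists>l. at X e i l p)
      else if i \<in> departed e then Top else Bot)"

definition lane_of :: "layout \<Rightarrow> env_state \<Rightarrow> agent \<Rightarrow> lane status" where
  "lane_of X e i =
     (if \<exists>l p. at X e i l p then Val (THE l. \<exists>p. at X e i l p)
      else if i \<in> departed e then Top else Bot)"

definition intent_of :: "env_state \<Rightarrow> agent \<Rightarrow> lane" where
  "intent_of e i = snd (snd (arrival (adv e) i))"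

text \<open>\<open>sensor_extra\<close> holds all further components of a sensor reading.\<close>

record 'ext sensor =
  sensor_front :: bool
  sensor_lane :: "lane status"
  sensor_intent :: lane
  sensor_extra :: 'ext


section \<open>Information exchange and contexts\<close>

datatype action = Go | Noop

type_synonym ('mem, 'ext) local_state = "'mem \<times> 'ext sensor"

text \<open>The memory, sensor and message sets of the individual agents are subsets of common types.
  A broadcast value \<open>None\<close> means that no message is sent.\<close>

record ('mem, 'ext, 'msg) exchange =
  memory :: "agent \<Rightarrow> 'mem set"
  init_memory :: "agent \<Rightarrow> 'mem set"
  sensor_values :: "agent \<Rightarrow> 'ext sensor set"
  extra_reading :: "agent \<Rightarrow> env_state \<Rightarrow> 'ext"
  messages :: "agent \<Rightarrow> 'msg set"
  broadcast :: "agent \<Rightarrow> ('mem, 'ext) local_state \<Rightarrow> action \<Rightarrow> 'ext sensor \<Rightarrow> 'msg option"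
  update :: "agent \<Rightarrow> ('mem, 'ext) local_state \<Rightarrow> action \<Rightarrow> 'msg set \<Rightarrow> 'mem"

definition reading ::
  "layout \<Rightarrow> ('mem, 'ext, 'msg) exchange \<Rightarrow> agent \<Rightarrow> env_state \<Rightarrow> 'ext sensor" where
  "reading X E i e =
     \<lparr>sensor_front = (pos_of X e i = Val 0),
      sensor_lane = lane_of X e i,
      sensor_intent = intent_of e i,
      sensor_extra = extra_reading E i e\<rparr>"

definition local_states ::
  "('mem, 'ext, 'msg) exchange \<Rightarrow> agent \<Rightarrow> ('mem, 'ext) local_state set" where
  "local_states E i = memory E i \<times> sensor_values E i"

definition valid_exchange :: "layout \<Rightarrow> ('mem, 'ext, 'msg) exchange \<Rightarrow> bool" where
  "valid_exchange X E \<longleftrightarrow> (\<forall>i\<in>agents X.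
     init_memory E i \<subseteq> memory E i \<and>
     (\<forall>s\<in>local_states E i. \<forall>a. \<forall>\<sigma>\<in>sensor_values E i.
        broadcast E i s a \<sigma> \<in> insert None (Some ` messages E i)) \<and>
     (\<forall>s\<in>local_states E i. \<forall>a. \<forall>B. B \<subseteq> (\<Union>j\<in>agents X. messages E j) \<longrightarrow>
        update E i s a B \<in> memory E i))"

record ('mem, 'ext) global_state =
  env :: env_state
  loc :: "agent \<Rightarrow> ('mem, 'ext) local_state"

datatype atom =
    Front agent
  | Lane agent "lane status"
  | Intent agent lane
  | Pos agent "nat status"

record ('mem, 'ext, 'msg) icontext =
  exch :: "('mem, 'ext, 'msg) exchange"
  adv_model :: "adversary set"
  interp :: "('mem, 'ext) global_state \<Rightarrow> atom \<Rightarrow> bool"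

definition global_states ::
  "layout \<Rightarrow> ('mem, 'ext, 'msg) icontext \<Rightarrow> ('mem, 'ext) global_state set" where
  "global_states X \<gamma> = {g.
     env g \<in> env_states X (adv_model \<gamma>) \<and>
     loc g \<in> (\<Pi>\<^sub>E i\<in>agents X. local_states (exch \<gamma>) i)}"

definition valid_context :: "layout \<Rightarrow> ('mem, 'ext, 'msg) icontext \<Rightarrow> bool" where
  "valid_context X \<gamma> \<longleftrightarrow>
     valid_exchange X (exch \<gamma>) \<and>
     adv_model \<gamma> \<subseteq> adversaries X \<and>
     (\<forall>e\<in>env_states X (adv_model \<gamma>). \<forall>i\<in>agents X.
        reading X (exch \<gamma>) i e \<in> sensor_values (exch \<gamma>) i) \<and>
     (\<forall>g\<in>global_states X \<gamma>. \<forall>i\<in>agents X.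
        (interp \<gamma> g (Front i) \<longleftrightarrow> pos_of X (env g) i = Val 0) \<and>
        (\<forall>v. interp \<gamma> g (Lane i v) \<longleftrightarrow> lane_of X (env g) i = v) \<and>
        (\<forall>d. interp \<gamma> g (Intent i d) \<longleftrightarrow> intent_of (env g) i = d) \<and>
        (\<forall>v. interp \<gamma> g (Pos i v) \<longleftrightarrow> pos_of X (env g) i = v))"


section \<open>Action protocols and runs\<close>

type_synonym ('mem, 'ext) protocol = "agent \<Rightarrow> ('mem, 'ext) local_state \<Rightarrow> action"

definition action_protocol ::
  "layout \<Rightarrow> ('mem, 'ext, 'msg) icontext \<Rightarrow> ('mem, 'ext) protocol \<Rightarrow> bool" where
  "action_protocol X \<gamma> P \<longleftrightarrow>
     (\<forall>i\<in>agents X. \<forall>s\<in>local_states (exch \<gamma>) i. P i s = Go \<longrightarrow> sensor_front (snd s))"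

definition initial_states ::
  "layout \<Rightarrow> ('mem, 'ext, 'msg) icontext \<Rightarrow> ('mem, 'ext) global_state set" where
  "initial_states X \<gamma> = {g.
     adv (env g) \<in> adv_model \<gamma> \<and>
     clock (env g) = 0 \<and>
     queue (env g) = (\<lambda>_. []) \<and>
     departed (env g) = {} \<and>
     loc g \<in> (\<Pi>\<^sub>E i\<in>agents X. init_memory (exch \<gamma>) i \<times> {reading X (exch \<gamma>) i (env g)})}"

text \<open>At most one agent arrives in a given lane at a given time.\<close>

definition arrivals :: "layout \<Rightarrow> adversary \<Rightarrow> nat \<Rightarrow> lane \<Rightarrow> agent list" where
  "arrivals X \<alpha> t l =
     (if \<exists>i\<in>agents X. \<exists>l'. arrival \<alpha> i = (t, l, l')
      then [THE i. i \<in> agents X \<and> (\<exists>l'. arrival \<alpha> i = (t, l, l'))] else [])"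

definition env_step :: "layout \<Rightarrow> (agent \<Rightarrow> action) \<Rightarrow> env_state \<Rightarrow> env_state" where
  "env_step X act e = e
     \<lparr>clock := Suc (clock e),
      queue := (\<lambda>l.
        (if queue e l \<noteq> [] \<and> act (hd (queue e l)) = Go then tl (queue e l) else queue e l)
        @ arrivals X (adv e) (Suc (clock e)) l),
      departed := departed e \<union> {i. (\<exists>l. at X e i l 0) \<and> act i = Go}\<rparr>"

text \<open>Here \<open>m\<close> is the time at the beginning of the round, \<open>e\<close> the environment state at its end,
  and \<open>msg j\<close> what agent \<open>j\<close> broadcasts. An agent in no queue of \<open>e\<close> receives nothing.\<close>

definition received ::
  "layout \<Rightarrow> nat \<Rightarrow> env_state \<Rightarrow> (agent \<Rightarrow> 'msg option) \<Rightarrow> agent \<Rightarrow> 'msg set" where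
  "received X m e msg i =
     (if receiver_ok (adv e) m i
      then {x. \<exists>j\<in>agents X. \<exists>l p l' p'.
              at X e j l p \<and> at X e i l' p' \<and>
              ((l, p), (l', p')) \<in> transmission (adv e) \<and>
              transmitter_ok (adv e) m j \<and> msg j = Some x}
      else {})"

definition step ::
  "layout \<Rightarrow> ('mem, 'ext, 'msg) icontext \<Rightarrow> ('mem, 'ext) protocol \<Rightarrow>
   ('mem, 'ext) global_state \<Rightarrow> ('mem, 'ext) global_state" where
  "step X \<gamma> P g =
     (let act = (\<lambda>i. P i (loc g i));
          e' = env_step X act (env g);
          msg = (\<lambda>i. broadcast (exch \<gamma>) i (loc g i) (act i) (reading X (exch \<gamma>) i e'));
          B = received X (clock (env g)) e' msg
      in \<lparr>env = e',
          loc = (\<lambda>i\<in>agents X.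
            (update (exch \<gamma>) i (loc g i) (act i) (B i), reading X (exch \<gamma>) i e'))\<rparr>)"

type_synonym ('mem, 'ext) run = "nat \<Rightarrow> ('mem, 'ext) global_state"

definition runs ::
  "layout \<Rightarrow> ('mem, 'ext, 'msg) icontext \<Rightarrow> ('mem, 'ext) protocol \<Rightarrow> ('mem, 'ext) run set" where
  "runs X \<gamma> P = {r. r 0 \<in> initial_states X \<gamma> \<and> (\<forall>m. r (Suc m) = step X \<gamma> P (r m))}"


section \<open>Intersection protocols\<close>

text \<open>Formulas are represented by their truth value at the points of a run.\<close>

type_synonym ('mem, 'ext) formula = "('mem, 'ext) run \<Rightarrow> nat \<Rightarrow> bool"

definition holds :: "('mem, 'ext, 'msg) icontext \<Rightarrow> atom \<Rightarrow> ('mem, 'ext) formula" where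
  "holds \<gamma> a r m \<longleftrightarrow> interp \<gamma> (r m) a"

definition next_time :: "('mem, 'ext) formula \<Rightarrow> ('mem, 'ext) formula" where
  "next_time \<phi> r m \<longleftrightarrow> \<phi> r (m + 1)"

definition sometime :: "('mem, 'ext) formula \<Rightarrow> ('mem, 'ext) formula" where
  "sometime \<phi> r m \<longleftrightarrow> (\<exists>m'\<ge>m. \<phi> r m')"

definition valid ::
  "layout \<Rightarrow> ('mem, 'ext, 'msg) icontext \<Rightarrow> ('mem, 'ext) protocol \<Rightarrow> ('mem, 'ext) formula \<Rightarrow> bool"
  where "valid X \<gamma> P \<phi> \<longleftrightarrow> (\<forall>r\<in>runs X \<gamma> P. \<forall>m. \<phi> r m)"

definition front :: "('mem, 'ext, 'msg) icontext \<Rightarrow> agent \<Rightarrow> ('mem, 'ext) formula" where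
  "front \<gamma> i = holds \<gamma> (Front i)"

definition going :: "('mem, 'ext, 'msg) icontext \<Rightarrow> agent \<Rightarrow> ('mem, 'ext) formula" where
  "going \<gamma> i r m \<longleftrightarrow> front \<gamma> i r m \<and> next_time (\<lambda>r m. \<not> front \<gamma> i r m) r m"

text \<open>The formula \<open>((lane\<^sub>i, intent\<^sub>i), (lane\<^sub>j, intent\<^sub>j)) \<in> compatible X\<close>, false if \<open>i\<close> or \<open>j\<close> is in
  no queue.\<close>

definition compatible_moves ::
  "layout \<Rightarrow> ('mem, 'ext, 'msg) icontext \<Rightarrow> agent \<Rightarrow> agent \<Rightarrow> ('mem, 'ext) formula" where
  "compatible_moves X \<gamma> i j r m \<longleftrightarrow> (\<exists>l d l' d'.
     holds \<gamma> (Lane i (Val l)) r m \<and> holds \<gamma> (Intent i d) r m \<and>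
     holds \<gamma> (Lane j (Val l')) r m \<and> holds \<gamma> (Intent j d') r m \<and>
     ((l, d), (l', d')) \<in> compatible X)"

definition intersection_protocol ::
  "layout \<Rightarrow> ('mem, 'ext, 'msg) icontext \<Rightarrow> ('mem, 'ext) protocol \<Rightarrow> bool" where
  "intersection_protocol X \<gamma> P \<longleftrightarrow>
     action_protocol X \<gamma> P \<and>
     (\<forall>i\<in>agents X. valid X \<gamma> P (\<lambda>r m. going \<gamma> i r m \<longrightarrow> front \<gamma> i r m)) \<and>
     (\<forall>i\<in>agents X. \<forall>j\<in>agents X. i \<noteq> j \<longrightarrow>
        valid X \<gamma> P (\<lambda>r m. going \<gamma> i r m \<and> going \<gamma> j r m \<longrightarrow> compatible_moves X \<gamma> i j r m)) \<and>
     (\<forall>i\<in>agents X. valid X \<gamma> P (\<lambda>r m. front \<gamma> i r m \<longrightarrow> sometime (going \<gamma> i) r m))"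


section \<open>Unnecessary waiting and lexicographic optimality\<close>

definition GO ::
  "layout \<Rightarrow> ('mem, 'ext, 'msg) icontext \<Rightarrow> ('mem, 'ext) run \<Rightarrow> nat \<Rightarrow> agent set" where
  "GO X \<gamma> r m = {i \<in> agents X. going \<gamma> i r m}"

definition safe_to_go ::
  "layout \<Rightarrow> ('mem, 'ext, 'msg) icontext \<Rightarrow> agent \<Rightarrow> ('mem, 'ext) formula" where
  "safe_to_go X \<gamma> i r m \<longleftrightarrow>
     holds \<gamma> (Pos i (Val 0)) r m \<and>
     (\<forall>j \<in> GO X \<gamma> r m \<union> {i}. \<forall>k \<in> GO X \<gamma> r m \<union> {i}. j \<noteq> k \<longrightarrow> compatible_moves X \<gamma> j k r m)"

definition unnecessary_waiting ::
  "layout \<Rightarrow> ('mem, 'ext, 'msg) icontext \<Rightarrow> ('mem, 'ext) protocol \<Rightarrow> bool" where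
  "unnecessary_waiting X \<gamma> P \<longleftrightarrow>
     (\<exists>i\<in>agents X. \<exists>r\<in>runs X \<gamma> P. \<exists>m. safe_to_go X \<gamma> i r m \<and> i \<notin> GO X \<gamma> r m)"

definition corresponding :: "('mem, 'ext) run \<Rightarrow> ('mem, 'ext) run \<Rightarrow> bool" where
  "corresponding r r' \<longleftrightarrow> r 0 = r' 0"

definition lex_dominates ::
  "layout \<Rightarrow> ('mem, 'ext, 'msg) icontext \<Rightarrow>
   ('mem, 'ext) protocol \<Rightarrow> ('mem, 'ext) protocol \<Rightarrow> bool" where
  "lex_dominates X \<gamma> P P' \<longleftrightarrow>
     (\<forall>r\<in>runs X \<gamma> P. \<forall>r'\<in>runs X \<gamma> P'. corresponding r r' \<longrightarrow>
        (\<forall>m. GO X \<gamma> r m = GO X \<gamma> r' m) \<or>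
        (\<exists>m. (\<forall>m'<m. GO X \<gamma> r m' = GO X \<gamma> r' m') \<and> GO X \<gamma> r' m \<subset> GO X \<gamma> r m))"

definition strictly_lex_dominates ::
  "layout \<Rightarrow> ('mem, 'ext, 'msg) icontext \<Rightarrow>
   ('mem, 'ext) protocol \<Rightarrow> ('mem, 'ext) protocol \<Rightarrow> bool" where
  "strictly_lex_dominates X \<gamma> P P' \<longleftrightarrow> lex_dominates X \<gamma> P P' \<and> \<not> lex_dominates X \<gamma> P' P"

definition lex_optimal ::
  "layout \<Rightarrow> ('mem, 'ext, 'msg) icontext \<Rightarrow> ('mem, 'ext) protocol \<Rightarrow> bool" where
  "lex_optimal X \<gamma> P \<longleftrightarrow>
     intersection_protocol X \<gamma> P \<and>
     \<not> (\<exists>P'. intersection_protocol X \<gamma> P' \<and> strictly_lex_dominates X \<gamma> P' P)"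

end

(* Suppose an intersection protocol P' strictly dominates P, and look at the first time m at which
   two corresponding runs r of P and r' of P' have different GO sets. Since the GO sets determine
   how the environment evolves, the environment states of r and r' agree up to time m. The
   domination gives GO(r,m) < GO(r',m), and by Safety for P' any agent i in the difference is
   compatible with all of GO(r,m). So P makes i wait unnecessarily. *)

theory Submission imports Defs begin

section \<open>Invariants of the environment\<close>

text \<open>As an agent arrives only once, the bounds on arrival times say that no agent can reappear
  after leaving its queue.\<close>

definition consistent :: "layout \<Rightarrow> env_state \<Rightarrow> bool" where
  "consistent X e \<longleftrightarrow>
     adv e \<in> adversaries X \<and>
     (\<forall>l. distinct (queue e l)) \<and>
     (\<forall>l. \<forall>i\<in>set (queue e l). i \<in> agents X \<and> i \<notin> departed e \<and>
        fst (arrival (adv e) i) \<le> clock e \<and> fst (snd (arrival (adv e) i)) = l) \<and>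
     (\<forall>i\<in>departed e. i \<in> agents X \<and> fst (arrival (adv e) i) \<le> clock e)"

section \<open>Arrivals and places of agents in a single environment state\<close>

lemma arrival_lane:
  assumes "\<alpha> \<in> adversaries X" "i \<in> agents X"
  shows "fst (snd (arrival \<alpha> i)) \<in> in_lanes X"
proof -
  have "arrival \<alpha> i \<in> UNIV \<times> in_lanes X \<times> out_lanes X"
    using assms unfolding adversaries_def by (blast dest: PiE_mem)
  then show ?thesis by auto
qed

text \<open>Distinct agents arriving at the same time use different lanes, so the \<open>THE\<close>
  in \<open>arrivals\<close> picks the only candidate.\<close>

lemma arrivals_cases:
  assumes "\<alpha> \<in> adversaries X"
  obtains "arrivals X \<alpha> t l = []"
  | i l' where "arrivals X \<alpha> t l = [i]" "i \<in> agents X" "arrival \<alpha> i = (t, l, l')"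
proof (cases "\<exists>i\<in>agents X. \<exists>l'. arrival \<alpha> i = (t, l, l')")
  case True
  then obtain i l' where i: "i \<in> agents X" "arrival \<alpha> i = (t, l, l')" by blast
  have distinct_lanes: "\<forall>i\<in>agents X. \<forall>j\<in>agents X.
      i \<noteq> j \<and> fst (arrival \<alpha> i) = fst (arrival \<alpha> j) \<longrightarrow>
        fst (snd (arrival \<alpha> i)) \<noteq> fst (snd (arrival \<alpha> j))"
    using assms unfolding adversaries_def by blast
  have "(THE j. j \<in> agents X \<and> (\<exists>l'. arrival \<alpha> j = (t, l, l'))) = i"
    using i distinct_lanes by (intro the_equality) (auto, metis fst_conv snd_conv)
  then show ?thesis using True i that(2) unfolding arrivals_def by simp
next
  case False
  then show ?thesis using that(1) unfolding arrivals_def by simp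
qed

lemma set_arrivals:
  assumes "\<alpha> \<in> adversaries X" "i \<in> set (arrivals X \<alpha> t l)"
  shows "i \<in> agents X" "fst (arrival \<alpha> i) = t" "fst (snd (arrival \<alpha> i)) = l"
  using assms(2) by (auto intro: arrivals_cases[OF assms(1), of t l])

lemma distinct_arrivals:
  "\<alpha> \<in> adversaries X \<Longrightarrow> distinct (arrivals X \<alpha> t l)"
  by (auto elim: arrivals_cases[of \<alpha> X t l])

text \<open>Links the two notions of front in \<open>env_step\<close>: dequeuing inspects the head
  of the list, whereas \<open>departed\<close> uses \<open>at\<close>, which also demands an
  incoming lane. A queued agent's arrival lane is the lane of its queue, so a nonempty queue sits on
  an incoming lane.\<close>

lemma consistent_at_front:
  assumes "consistent X e"
  shows "at X e i l 0 \<longleftrightarrow> queue e l \<noteq> [] \<and> hd (queue e l) = i"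
proof
  assume "queue e l \<noteq> [] \<and> hd (queue e l) = i"
  then have i: "queue e l \<noteq> []" "hd (queue e l) = i" by auto
  then have "i \<in> set (queue e l)" by auto
  then have "i \<in> agents X" "fst (snd (arrival (adv e) i)) = l"
    using assms unfolding consistent_def by auto
  then have "l \<in> in_lanes X"
    using arrival_lane[of "adv e" X i] assms unfolding consistent_def by auto
  then show "at X e i l 0" using i unfolding at_def by (simp add: hd_conv_nth)
qed (auto simp: at_def hd_conv_nth)

text \<open>The arrival lane determines the queue of an agent and distinctness determines its
  position, which gives the uniqueness of places demanded by \<open>env_states\<close>.\<close>

lemma consistent_env_states:
  assumes "consistent X e" "adv e \<in> F"
  shows "e \<in> env_states X F"
proof -
  have at: "i \<in> set (queue e l)" if "at X e i l p" for i l p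
    using that by (auto simp: at_def)
  have unique: "l = l' \<and> p = p'" if "at X e i l p" "at X e i l' p'" for i l p l' p'
  proof -
    have "l = l'" using at that assms(1) unfolding consistent_def by metis
    moreover have "distinct (queue e l)" using assms(1) unfolding consistent_def by blast
    ultimately show ?thesis using that unfolding at_def by (metis nth_eq_iff_index_eq)
  qed
  have empty: "queue e l = []" if "l \<notin> in_lanes X" for l
  proof (rule ccontr)
    assume "queue e l \<noteq> []"
    then have "hd (queue e l) \<in> set (queue e l)" by simp
    then show False
      using that assms(1) arrival_lane[of "adv e" X "hd (queue e l)"] unfolding consistent_def by metis
  qed
  show ?thesis
    using assms at unique empty unfolding env_states_def consistent_def by blast
qed

section \<open>One round of the environment\<close>

lemma adv_env_step [simp]: "adv (env_step X act e) = adv e"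
  by (simp add: env_step_def)

text \<open>The queue of an agent is fixed by its arrival lane and lists it once, so dequeuing
  removes it everywhere. The arrival disjunct stays open here; \<open>leaves_front_iff\<close>
  closes it by comparing arrival times.\<close>

lemma set_queue_env_step:
  assumes "consistent X e" "i \<in> set (queue (env_step X act e) l)"
  shows "(i \<in> set (queue e l) \<and> \<not> ((\<exists>l. at X e i l 0) \<and> act i = Go)) \<or>
    i \<in> set (arrivals X (adv e) (Suc (clock e)) l)"
proof (cases "i \<in> set (arrivals X (adv e) (Suc (clock e)) l)")
  case False
  \<comment> \<open>The queue after departures, before new arrivals are appended.\<close>
  define q where "q = (if queue e l \<noteq> [] \<and> act (hd (queue e l)) = Go
    then tl (queue e l) else queue e l)"
  have iq: "i \<in> set q" using False assms(2) unfolding env_step_def q_def by auto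
  then have i: "i \<in> set (queue e l)"
    unfolding q_def by (auto split: if_splits dest: list.set_sel(2)[rotated])
  have False if "at X e i l' 0" "act i = Go" for l'
  proof -
    have "i \<in> set (queue e l')" "queue e l' \<noteq> []" "hd (queue e l') = i"
      using that consistent_at_front[OF assms(1)] by auto
    moreover have "l' = l"
      using i calculation(1) assms(1) unfolding consistent_def by metis
    moreover have "distinct (queue e l)" using assms(1) unfolding consistent_def by blast
    ultimately show False
      using iq that(2) unfolding q_def by (cases "queue e l") auto
  qed
  then show ?thesis using i by blast
qed simp

text \<open>New arrivals carry arrival time \<open>Suc (clock e)\<close>, while everyone queued or
  departed before arrived by \<open>clock e\<close>; so a newcomer is neither queued nor departed
  already.\<close>

lemma consistent_env_step:
  assumes "consistent X e"
  shows "consistent X (env_step X act e)"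
proof -
  let ?e = "env_step X act e"
  have adv: "adv e \<in> adversaries X" using assms unfolding consistent_def by blast
  have clock: "clock ?e = Suc (clock e)" by (simp add: env_step_def)
  have dep: "departed ?e = departed e \<union> {i. (\<exists>l. at X e i l 0) \<and> act i = Go}"
    by (simp add: env_step_def)
  have queued: "i \<in> agents X \<and> i \<notin> departed e \<and> fst (arrival (adv e) i) \<le> clock e \<and>
      fst (snd (arrival (adv e) i)) = l" if "i \<in> set (queue e l)" for i l
    using that assms unfolding consistent_def by blast
  \<comment> \<open>The bound is \<open>clock e\<close>, not \<open>Suc (clock e)\<close>: agents
    departing in this round were queued before it. The gap keeps newcomers out of
    \<open>departed ?e\<close>.\<close>
  have departed: "i \<in> agents X \<and> fst (arrival (adv e) i) \<le> clock e" if "i \<in> departed ?e" for i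
  proof (cases "i \<in> departed e")
    case True
    then show ?thesis using assms unfolding consistent_def by blast
  next
    case False
    then obtain l where "at X e i l 0" using \<open>i \<in> departed ?e\<close> dep by auto
    then have "i \<in> set (queue e l)" using consistent_at_front[OF assms] by auto
    then show ?thesis using queued by blast
  qed
  have "distinct (queue ?e l)" for l
  proof -
    have "distinct (queue e l)" using assms unfolding consistent_def by blast
    moreover have "set (queue e l) \<inter> set (arrivals X (adv e) (Suc (clock e)) l) = {}"
      using queued set_arrivals(2)[OF adv] by fastforce
    ultimately show ?thesis
      using distinct_arrivals[OF adv] list.set_sel(2)[of "queue e l"]
      unfolding env_step_def by (auto simp: distinct_tl)
  qed
  moreover have "i \<in> agents X \<and> i \<notin> departed ?e \<and> fst (arrival (adv e) i) \<le> Suc (clock e) \<and>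
      fst (snd (arrival (adv e) i)) = l" if "i \<in> set (queue ?e l)" for i l
  proof (cases "i \<in> set (arrivals X (adv e) (Suc (clock e)) l)")
    case True
    then show ?thesis using set_arrivals[OF adv True] departed[of i] by auto
  next
    case False
    then have "i \<in> set (queue e l)" "\<not> ((\<exists>l. at X e i l 0) \<and> act i = Go)"
      using set_queue_env_step[OF assms that] by auto
    then show ?thesis using queued[of i l] dep by auto
  qed
  ultimately show ?thesis
    using adv departed unfolding consistent_def clock adv_env_step by (meson le_SucI)
qed

section \<open>Agents at the front and the actions that make them leave it\<close>

lemma pos_of_front:
  assumes "e \<in> env_states X F"
  shows "pos_of X e i = Val 0 \<longleftrightarrow> (\<exists>l. at X e i l 0)"
proof -
  have unique: "p = p'" if "at X e i l p" "at X e i l' p'" for l p l' p'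
    using that assms unfolding env_states_def by blast
  have "(THE p. \<exists>l. at X e i l p) = p" if "at X e i l p" for l p
    using that unique by (intro the_equality) blast+
  then show ?thesis unfolding pos_of_def by (metis status.distinct(1,3) status.inject)
qed

text \<open>Arrivals are appended at the back, so a head that does not go stays the head.
  Conversely, an agent that goes loses its only place and cannot arrive again, its arrival time
  being at most \<open>clock e\<close>.\<close>

lemma leaves_front_iff:
  assumes "consistent X e"
  shows "(\<exists>l. at X e i l 0) \<and> \<not> (\<exists>l. at X (env_step X act e) i l 0) \<longleftrightarrow>
    (\<exists>l. at X e i l 0) \<and> act i = Go"
proof (intro iffI; elim conjE exE)
  fix l assume l: "at X e i l 0" and "\<not> (\<exists>l. at X (env_step X act e) i l 0)"
  then have "\<not> at X (env_step X act e) i l 0" by blast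
  with l have "act i \<noteq> Noop"
    unfolding at_def env_step_def by (auto simp: hd_conv_nth nth_append split: if_splits)
  then show "(\<exists>l. at X e i l 0) \<and> act i = Go" using l by (cases "act i") auto
next
  fix l assume l: "at X e i l 0" and go: "act i = Go"
  have adv: "adv e \<in> adversaries X" using assms unfolding consistent_def by blast
  have "i \<in> set (queue e l)" using l consistent_at_front[OF assms] by auto
  then have "fst (arrival (adv e) i) \<le> clock e" using assms unfolding consistent_def by blast
  then have "i \<notin> set (arrivals X (adv e) (Suc (clock e)) l')" for l'
    using set_arrivals(2)[OF adv] by fastforce
  then have "i \<notin> set (queue (env_step X act e) l')" for l'
    using set_queue_env_step[OF assms] l go by blast
  then show "(\<exists>l. at X e i l 0) \<and> \<not> (\<exists>l. at X (env_step X act e) i l 0)"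
    using l unfolding at_def by (metis nth_mem)
qed

text \<open>Agreement is asked for only at queue fronts, since \<open>env_step\<close> consults no
  other actions; this is exactly the information that GO sets supply.\<close>

lemma env_step_cong:
  assumes "consistent X e" "\<And>i l. at X e i l 0 \<Longrightarrow> act i = Go \<longleftrightarrow> act' i = Go"
  shows "env_step X act e = env_step X act' e"
proof -
  have "queue e l \<noteq> [] \<and> act (hd (queue e l)) = Go \<longleftrightarrow>
      queue e l \<noteq> [] \<and> act' (hd (queue e l)) = Go" for l
    using assms(2) consistent_at_front[OF assms(1)] by blast
  moreover have "(\<exists>l. at X e i l 0) \<and> act i = Go \<longleftrightarrow> (\<exists>l. at X e i l 0) \<and> act' i = Go" for i
    using assms(2) by blast
  ultimately show ?thesis unfolding env_step_def by (simp only:)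
qed


section \<open>Runs\<close>

lemma env_step_env: "env (step X \<gamma> P g) = env_step X (\<lambda>i. P i (loc g i)) (env g)"
  by (simp add: step_def Let_def)

text \<open>Membership in \<open>global_states\<close> is carried along with the invariant because
  \<open>valid_context\<close> fixes the meaning of the atoms only there.\<close>

lemma initial_consistent:
  assumes "valid_context X \<gamma>" "g \<in> initial_states X \<gamma>"
  shows "consistent X (env g) \<and> g \<in> global_states X \<gamma>"
proof -
  have con: "consistent X (env g)"
    using assms unfolding consistent_def initial_states_def valid_context_def by auto
  then have e: "env g \<in> env_states X (adv_model \<gamma>)"
    using assms(2) by (intro consistent_env_states) (auto simp: initial_states_def)
  have "loc g \<in> (\<Pi>\<^sub>E i\<in>agents X. init_memory (exch \<gamma>) i \<times> {reading X (exch \<gamma>) i (env g)})"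
    using assms(2) unfolding initial_states_def by blast
  moreover have "init_memory (exch \<gamma>) i \<times> {reading X (exch \<gamma>) i (env g)} \<subseteq>
      local_states (exch \<gamma>) i" if "i \<in> agents X" for i
    using that assms(1) e unfolding valid_context_def valid_exchange_def local_states_def by blast
  ultimately have "loc g \<in> (\<Pi>\<^sub>E i\<in>agents X. local_states (exch \<gamma>) i)"
    by (rule subsetD[OF PiE_mono, rotated])
  then show ?thesis using con e unfolding global_states_def by blast
qed

lemma step_consistent:
  assumes "valid_context X \<gamma>" "consistent X (env g)" "g \<in> global_states X \<gamma>"
  shows "consistent X (env (step X \<gamma> P g)) \<and> step X \<gamma> P g \<in> global_states X \<gamma>"
proof -
  let ?act = "\<lambda>i. P i (loc g i)"
  let ?e = "env_step X ?act (env g)"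
  let ?msg = "\<lambda>i. broadcast (exch \<gamma>) i (loc g i) (?act i) (reading X (exch \<gamma>) i ?e)"
  let ?B = "received X (clock (env g)) ?e ?msg"
  have con: "consistent X ?e" using assms(2) by (rule consistent_env_step)
  have "adv (env g) \<in> adv_model \<gamma>"
    using assms(3) unfolding global_states_def env_states_def by blast
  then have e: "?e \<in> env_states X (adv_model \<gamma>)"
    using con by (intro consistent_env_states) simp_all
  have loc: "loc g i \<in> local_states (exch \<gamma>) i" if "i \<in> agents X" for i
    using that assms(3) unfolding global_states_def by (blast dest: PiE_mem)
  have reading: "reading X (exch \<gamma>) i ?e \<in> sensor_values (exch \<gamma>) i" if "i \<in> agents X" for i
    using that assms(1) e unfolding valid_context_def by blast
  have exch: "valid_exchange X (exch \<gamma>)" using assms(1) unfolding valid_context_def by blast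
  have msg: "?msg j \<in> insert None (Some ` messages (exch \<gamma>) j)" if "j \<in> agents X" for j
    using exch loc[OF that] reading[OF that] that unfolding valid_exchange_def by blast
  \<comment> \<open>\<open>valid_exchange\<close> keeps \<open>update\<close> inside
    \<open>memory\<close> only for sets of agents' messages, so the received set must be shown to be
    one.\<close>
  have "?B i \<subseteq> (\<Union>j\<in>agents X. messages (exch \<gamma>) j)" for i
  proof
    fix x assume "x \<in> ?B i"
    then obtain j where j: "j \<in> agents X" "?msg j = Some x"
      unfolding received_def by (auto split: if_splits)
    then show "x \<in> (\<Union>j\<in>agents X. messages (exch \<gamma>) j)" using msg[OF j(1)] by auto
  qed
  then have "update (exch \<gamma>) i (loc g i) (?act i) (?B i) \<in> memory (exch \<gamma>) i"
    if "i \<in> agents X" for i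
    using exch loc[OF that] that unfolding valid_exchange_def by blast
  then have "loc (step X \<gamma> P g) \<in> (\<Pi>\<^sub>E i\<in>agents X. local_states (exch \<gamma>) i)"
    using reading unfolding step_def Let_def local_states_def by (auto simp: restrict_def)
  then show ?thesis using con e unfolding global_states_def by (simp add: env_step_env)
qed

lemma run_consistent:
  assumes "valid_context X \<gamma>" "r \<in> runs X \<gamma> P"
  shows "consistent X (env (r m)) \<and> r m \<in> global_states X \<gamma>"
proof (induction m)
  case 0
  then show ?case using assms initial_consistent unfolding runs_def by blast
next
  case (Suc m)
  have "r (Suc m) = step X \<gamma> P (r m)" using assms(2) unfolding runs_def by blast
  then show ?case using Suc step_consistent[OF assms(1)] by metis
qed

text \<open>Reduces the atoms to conditions on \<open>env (r m)\<close>, so that equal environments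
  suffice to transfer formulas between runs of different protocols.\<close>

lemma holds_run:
  assumes "valid_context X \<gamma>" "r \<in> runs X \<gamma> P" "i \<in> agents X"
  shows "holds \<gamma> (Front i) r m \<longleftrightarrow> (\<exists>l. at X (env (r m)) i l 0)"
    and "holds \<gamma> (Pos i (Val 0)) r m \<longleftrightarrow> (\<exists>l. at X (env (r m)) i l 0)"
    and "holds \<gamma> (Lane i v) r m \<longleftrightarrow> lane_of X (env (r m)) i = v"
    and "holds \<gamma> (Intent i d) r m \<longleftrightarrow> intent_of (env (r m)) i = d"
proof -
  have g: "r m \<in> global_states X \<gamma>" using run_consistent[OF assms(1,2)] by blast
  then have "env (r m) \<in> env_states X (adv_model \<gamma>)" unfolding global_states_def by blast
  note pos = pos_of_front[OF this]
  show "holds \<gamma> (Front i) r m \<longleftrightarrow> (\<exists>l. at X (env (r m)) i l 0)"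
    "holds \<gamma> (Pos i (Val 0)) r m \<longleftrightarrow> (\<exists>l. at X (env (r m)) i l 0)"
    "holds \<gamma> (Lane i v) r m \<longleftrightarrow> lane_of X (env (r m)) i = v"
    "holds \<gamma> (Intent i d) r m \<longleftrightarrow> intent_of (env (r m)) i = d"
    using g assms(1,3) unfolding holds_def pos[symmetric] valid_context_def by blast+
qed

text \<open>\<open>going\<close> compares two consecutive times; \<open>leaves_front_iff\<close>
  turns it into a condition on time \<open>m\<close> alone.\<close>

lemma going_iff:
  assumes "valid_context X \<gamma>" "r \<in> runs X \<gamma> P" "i \<in> agents X"
  shows "going \<gamma> i r m \<longleftrightarrow> (\<exists>l. at X (env (r m)) i l 0) \<and> P i (loc (r m) i) = Go"
proof -
  have "r (Suc m) = step X \<gamma> P (r m)" using assms(2) unfolding runs_def by blast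
  then have "env (r (Suc m)) = env_step X (\<lambda>i. P i (loc (r m) i)) (env (r m))"
    by (simp add: env_step_env)
  then show ?thesis
    using leaves_front_iff[of X "env (r m)" i "\<lambda>i. P i (loc (r m) i)"] run_consistent[OF assms(1,2)]
    unfolding going_def next_time_def front_def holds_run[OF assms] by simp
qed

section \<open>Comparison of two corresponding runs\<close>

lemma env_eq_if_GO_eq:
  assumes "valid_context X \<gamma>" "r \<in> runs X \<gamma> P" "r' \<in> runs X \<gamma> P'" "corresponding r r'"
    and "\<forall>k<m. GO X \<gamma> r k = GO X \<gamma> r' k"
  shows "env (r m) = env (r' m)"
  using assms(5)
proof (induction m)
  case 0
  then show ?case using assms(4) unfolding corresponding_def by simp
next
  case (Suc m)
  then have env: "env (r m) = env (r' m)" and GO: "GO X \<gamma> r m = GO X \<gamma> r' m" by auto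
  have con: "consistent X (env (r m))" using run_consistent[OF assms(1,2)] by blast
  \<comment> \<open>For an agent at the front, performing \<open>Go\<close> is the same as belonging
    to the GO set, so equal GO sets force equal actions at all fronts.\<close>
  have "P i (loc (r m) i) = Go \<longleftrightarrow> P' i (loc (r' m) i) = Go" if "at X (env (r m)) i l 0" for i l
  proof -
    have "i \<in> set (queue (env (r m)) l)" using that unfolding at_def by auto
    then have i: "i \<in> agents X" using con unfolding consistent_def by blast
    then have "going \<gamma> i r m \<longleftrightarrow> going \<gamma> i r' m" using GO unfolding GO_def by blast
    then show ?thesis
      using that going_iff[OF assms(1,2) i] going_iff[OF assms(1,3) i] env by auto
  qed
  then have "env_step X (\<lambda>i. P i (loc (r m) i)) (env (r m)) =
      env_step X (\<lambda>i. P' i (loc (r' m) i)) (env (r m))"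
    by (rule env_step_cong[OF con])
  moreover have "r (Suc m) = step X \<gamma> P (r m)" "r' (Suc m) = step X \<gamma> P' (r' m)"
    using assms(2,3) unfolding runs_def by blast+
  ultimately show ?case using env by (simp add: env_step_env)
qed

lemma compatible_moves_cong:
  assumes "valid_context X \<gamma>" "r \<in> runs X \<gamma> P" "r' \<in> runs X \<gamma> P'" "env (r m) = env (r' m)"
    and "i \<in> agents X" "j \<in> agents X"
  shows "compatible_moves X \<gamma> i j r m \<longleftrightarrow> compatible_moves X \<gamma> i j r' m"
  using assms(4) unfolding compatible_moves_def
    holds_run[OF assms(1,2,5)] holds_run[OF assms(1,2,6)]
    holds_run[OF assms(1,3,5)] holds_run[OF assms(1,3,6)] by simp

lemma unnecessary_waiting_if_GO_psubset:
  assumes "valid_context X \<gamma>" "r \<in> runs X \<gamma> P" "r' \<in> runs X \<gamma> P'"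
    and "intersection_protocol X \<gamma> P'"
    and "env (r m) = env (r' m)" "GO X \<gamma> r m \<subset> GO X \<gamma> r' m"
  shows "unnecessary_waiting X \<gamma> P"
proof -
  obtain i where i: "i \<in> GO X \<gamma> r' m" "i \<notin> GO X \<gamma> r m" using assms(6) by blast
  then have i_agent: "i \<in> agents X" unfolding GO_def by blast
  \<comment> \<open>All pairs that \<open>safe_to_go\<close> inspects in \<open>r\<close> thus
    consist of agents going together in \<open>r'\<close>, where Safety of \<open>P'\<close>
    applies.\<close>
  have sub: "GO X \<gamma> r m \<union> {i} \<subseteq> GO X \<gamma> r' m" using assms(6) i(1) by blast
  have "compatible_moves X \<gamma> j k r m"
    if "j \<in> GO X \<gamma> r m \<union> {i}" "k \<in> GO X \<gamma> r m \<union> {i}" "j \<noteq> k" for j k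
  proof -
    have jk: "j \<in> GO X \<gamma> r' m" "k \<in> GO X \<gamma> r' m" using that sub by blast+
    then have "compatible_moves X \<gamma> j k r' m"
      using that(3) assms(3,4) unfolding intersection_protocol_def valid_def GO_def by blast
    then show ?thesis
      using compatible_moves_cong[OF assms(1-3,5)] jk unfolding GO_def by blast
  qed
  \<comment> \<open>Going in \<open>r'\<close> puts \<open>i\<close> at a front of
    \<open>env (r' m)\<close>, which is also the environment of \<open>r\<close>.\<close>
  moreover have "holds \<gamma> (Pos i (Val 0)) r m"
    using i(1) going_iff[OF assms(1,3) i_agent] holds_run(2)[OF assms(1,2) i_agent] assms(5)
    unfolding GO_def by auto
  ultimately show ?thesis
    using i(2) i_agent assms(2) unfolding unnecessary_waiting_def safe_to_go_def by blast
qed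

theorem proposition9:
  fixes X :: layout
    and \<gamma> :: "('mem, 'ext, 'msg) icontext"
    and P :: "('mem, 'ext) protocol"
  assumes "valid_layout X"
    and "valid_context X \<gamma>"
    and "intersection_protocol X \<gamma> P"
    and "\<not> unnecessary_waiting X \<gamma> P"
  shows "lex_optimal X \<gamma> P"
proof -
  have False if P': "intersection_protocol X \<gamma> P'" "strictly_lex_dominates X \<gamma> P' P" for P'
  proof -
    \<comment> \<open>These runs witness that \<open>P\<close> does not dominate \<open>P'\<close>;
      in particular their GO sets differ somewhere.\<close>
    obtain r r' where runs: "r \<in> runs X \<gamma> P" "r' \<in> runs X \<gamma> P'" "corresponding r r'"
      and neq: "\<not> (\<forall>m. GO X \<gamma> r m = GO X \<gamma> r' m)"
      using P'(2) unfolding strictly_lex_dominates_def lex_dominates_def[of X \<gamma> P P'] by auto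
    have "corresponding r' r" using runs(3) unfolding corresponding_def by simp
    moreover have "lex_dominates X \<gamma> P' P"
      using P'(2) unfolding strictly_lex_dominates_def by blast
    \<comment> \<open>Domination by \<open>P'\<close>, applied to the same pair in swapped order,
      leaves only its second alternative, a first difference with a proper inclusion.\<close>
    ultimately obtain m where m: "\<forall>k<m. GO X \<gamma> r' k = GO X \<gamma> r k" "GO X \<gamma> r m \<subset> GO X \<gamma> r' m"
      using runs(1,2) neq unfolding lex_dominates_def by metis
    have "env (r m) = env (r' m)" using env_eq_if_GO_eq[OF assms(2) runs] m(1) by simp
    then show False
      using unnecessary_waiting_if_GO_psubset[OF assms(2) runs(1,2) P'(1)] m(2) assms(4) by blast
  qed
  then show ?thesis using assms(3) unfolding lex_optimal_def by blast
qed

end
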